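(* Let $(A,\mu)$ be a partially crossed topological $G$-$R$-bimodule. Then: (i) $H^{1}(G,(A,\mu))$ can be naturally embedded in $H^{1}(G,A)$ (via the natural map $\zeta:H^{1}(G,(A,\mu))\to H^{1}(G,A)$, $[(\alpha,r)]\mapsto[\alpha]$). (ii) There is a bijection between $H^{1}(G,(A,\mu))$ and $H^{1}(G,A)$ if and only if the induced map $\mu^{1}:H^{1}(G,A)\to H^{1}(G,R)$, $[\alpha]\mapsto[\mu\circ\alpha]$, is trivial.
   Context: Topological groups are not assumed abelian. A topological $G$-module is a topological group $A$ with a continuous left action of the topological group $G$ on $A$ by group automorphisms, written ${}^{g}a$. Every group acts on itself by conjugation. A precrossed topological $R$-module $(A,\mu)$ is a topological $R$-module $A$ with a continuous homomorphism $\mu:A\to R$ such that $\mu({}^{r}a)=r\mu(a)r^{-1}$. It is partially crossed if ${}^{\mu(a)}b=aba^{-1}$ for all $b\in A$ and all $a\in A$ with $\mu(a)\in[R,R]$. A partially crossed topological $G$-$R$-bimodule is a partially crossed topological $R$-module $(A,\mu)$ such that the topological group $G$ acts continuously on $R$ and $A$ (by automorphisms), $\mu({}^{g}a)={}^{g}\mu(a)$, and ${}^{({}^{g}r)}a={}^{g}({}^{r}({}^{g^{-1}}a))$ for all $g\in G,r\in R,a\in A$. For a topological $G$-module $M$, $H^1(G,M)$ is the pointed set of continuous crossed homomorphisms $\alpha:G\to M$ ($\alpha(gh)=\alpha(g)\,{}^{g}\alpha(h)$) modulo $\alpha\sim\beta$ iff there is $m\in M$ with $\beta(g)=m^{-1}\alpha(g)\,{}^{g}m$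 for all $g$; the base point is the class of the trivial homomorphism. A map is trivial if it sends everything to the base point. $Der_{c}(G,(A,\mu))$ is the set of pairs $(\alpha,r)$ with $\alpha:G\to A$ a continuous crossed homomorphism and $r\in R$ such that $\mu(\alpha(g))=r\,{}^{g}r^{-1}$ for all $g\in G$. $H^0(G,R)=\{r\in R: {}^{g}r=r\ \forall g\in G\}$. Put $(\alpha,r)\sim'(\beta,s)$ if there is $a\in A$ with $\beta(g)=a^{-1}\alpha(g)\,{}^{g}a$ for all $g\in G$ and $s\in\mu(a)^{-1}rH^{0}(G,R)$. $H^{1}(G,(A,\mu))=Der_{c}(G,(A,\mu))/\!\sim'$.
   Formalization: In (ii), "there is a bijection" is formalized as "the natural map ζ is a bijection"; for a bare bijection "only if" fails: G=R=Z/2, A a countable direct sum of copies of Z/2, discrete, trivial actions, μ the first coordinate. *)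

theory Defs
  imports "HOL-Analysis.Analysis" "HOL-Algebra.Generated_Groups"
begin

record 'a topgroup = "'a monoid" +
  topo :: "'a topology"

text \<open>As usual in HOL-Algebra, groups live on an explicit carrier. No commutativity and no
  separation axiom is assumed.\<close>

locale topological_group = group G for G :: "'a topgroup" (structure) +
  assumes topspace_topo: "topspace (topo G) = carrier G"
    and continuous_mult:
      "continuous_map (prod_topology (topo G) (topo G)) (topo G) (\<lambda>(x, y). x \<otimes> y)"
    and continuous_inv: "continuous_map (topo G) (topo G) (\<lambda>x. inv x)"

text \<open>That each \<open>act g\<close> is an automorphism of \<open>M\<close> follows: it is an endomorphism, with
  inverse \<open>act (inv g)\<close>.\<close>

locale topological_module =
  G: topological_group G + M: topological_group M
  for G :: "'g topgroup" and M :: "'m topgroup" and act :: "'g \<Rightarrow> 'm \<Rightarrow> 'm" +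
  assumes continuous_act:
      "continuous_map (prod_topology (topo G) (topo M)) (topo M) (\<lambda>(g, m). act g m)"
    and act_hom: "g \<in> carrier G \<Longrightarrow> act g \<in> hom M M"
    and act_one: "m \<in> carrier M \<Longrightarrow> act \<one>\<^bsub>G\<^esub> m = m"
    and act_mult: "\<lbrakk>g \<in> carrier G; h \<in> carrier G; m \<in> carrier M\<rbrakk>
      \<Longrightarrow> act (g \<otimes>\<^bsub>G\<^esub> h) m = act g (act h m)"

locale precrossed_topological_module =
  topological_module R A actRA
  for R :: "'r topgroup" and A :: "'a topgroup" and actRA :: "'r \<Rightarrow> 'a \<Rightarrow> 'a" +
  fixes \<mu> :: "'a \<Rightarrow> 'r"
  assumes mu_hom: "\<mu> \<in> hom A R"
    and continuous_mu: "continuous_map (topo A) (topo R) \<mu>"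
    and precrossed: "\<lbrakk>r \<in> carrier R; a \<in> carrier A\<rbrakk>
      \<Longrightarrow> \<mu> (actRA r a) = r \<otimes>\<^bsub>R\<^esub> \<mu> a \<otimes>\<^bsub>R\<^esub> inv\<^bsub>R\<^esub> r"

text \<open>Here \<open>[R,R]\<close> is the abstract commutator subgroup, without topological closure.\<close>

locale partially_crossed_topological_module =
  precrossed_topological_module R A actRA \<mu>
  for R :: "'r topgroup" and A :: "'a topgroup" and actRA :: "'r \<Rightarrow> 'a \<Rightarrow> 'a"
    and \<mu> :: "'a \<Rightarrow> 'r" +
  assumes partially_crossed:
    "\<lbrakk>a \<in> carrier A; b \<in> carrier A; \<mu> a \<in> derived R (carrier R)\<rbrakk>
      \<Longrightarrow> actRA (\<mu> a) b = a \<otimes>\<^bsub>A\<^esub> b \<otimes>\<^bsub>A\<^esub> inv\<^bsub>A\<^esub> a"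

locale partially_crossed_topological_bimodule =
  partially_crossed_topological_module R A actRA \<mu> +
  GR: topological_module G R actGR + GA: topological_module G A actGA
  for G :: "'g topgroup" and R :: "'r topgroup" and A :: "'a topgroup"
    and actGR :: "'g \<Rightarrow> 'r \<Rightarrow> 'r" and actGA :: "'g \<Rightarrow> 'a \<Rightarrow> 'a"
    and actRA :: "'r \<Rightarrow> 'a \<Rightarrow> 'a" and \<mu> :: "'a \<Rightarrow> 'r" +
  assumes mu_equivariant: "\<lbrakk>g \<in> carrier G; a \<in> carrier A\<rbrakk> \<Longrightarrow> \<mu> (actGA g a) = actGR g (\<mu> a)"
    and act_compatible: "\<lbrakk>g \<in> carrier G; r \<in> carrier R; a \<in> carrier A\<rbrakk>
      \<Longrightarrow> actRA (actGR g r) a = actGA g (actRA r (actGA (inv\<^bsub>G\<^esub> g) a))"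

text \<open>Crossed homomorphisms are taken extensional (\<open>undefined\<close> off the carrier), so that HOL
  functions correspond one-to-one to functions on the carrier.\<close>

definition crossed_homs ::
  "'g topgroup \<Rightarrow> 'm topgroup \<Rightarrow> ('g \<Rightarrow> 'm \<Rightarrow> 'm) \<Rightarrow> ('g \<Rightarrow> 'm) set" where
  "crossed_homs G M act = {\<alpha> \<in> carrier G \<rightarrow>\<^sub>E carrier M.
     continuous_map (topo G) (topo M) \<alpha> \<and>
     (\<forall>g \<in> carrier G. \<forall>h \<in> carrier G. \<alpha> (g \<otimes>\<^bsub>G\<^esub> h) = \<alpha> g \<otimes>\<^bsub>M\<^esub> act g (\<alpha> h))}"

definition cohomologous ::
  "'g topgroup \<Rightarrow> 'm topgroup \<Rightarrow> ('g \<Rightarrow> 'm \<Rightarrow> 'm) \<Rightarrow> (('g \<Rightarrow> 'm) \<times> ('g \<Rightarrow> 'm)) set" where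
  "cohomologous G M act = {(\<alpha>, \<beta>). \<alpha> \<in> crossed_homs G M act \<and> \<beta> \<in> crossed_homs G M act \<and>
     (\<exists>m \<in> carrier M. \<forall>g \<in> carrier G. \<beta> g = inv\<^bsub>M\<^esub> m \<otimes>\<^bsub>M\<^esub> \<alpha> g \<otimes>\<^bsub>M\<^esub> act g m)}"

definition H1 ::
  "'g topgroup \<Rightarrow> 'm topgroup \<Rightarrow> ('g \<Rightarrow> 'm \<Rightarrow> 'm) \<Rightarrow> ('g \<Rightarrow> 'm) set set" where
  "H1 G M act = crossed_homs G M act // cohomologous G M act"

definition H1_class ::
  "'g topgroup \<Rightarrow> 'm topgroup \<Rightarrow> ('g \<Rightarrow> 'm \<Rightarrow> 'm) \<Rightarrow> ('g \<Rightarrow> 'm) \<Rightarrow> ('g \<Rightarrow> 'm) set" where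
  "H1_class G M act \<alpha> = cohomologous G M act `` {\<alpha>}"

definition H1_base ::
  "'g topgroup \<Rightarrow> 'm topgroup \<Rightarrow> ('g \<Rightarrow> 'm \<Rightarrow> 'm) \<Rightarrow> ('g \<Rightarrow> 'm) set" where
  "H1_base G M act = H1_class G M act (\<lambda>g \<in> carrier G. \<one>\<^bsub>M\<^esub>)"

definition H0 :: "'g topgroup \<Rightarrow> 'm topgroup \<Rightarrow> ('g \<Rightarrow> 'm \<Rightarrow> 'm) \<Rightarrow> 'm set" where
  "H0 G M act = {m \<in> carrier M. \<forall>g \<in> carrier G. act g m = m}"

definition Der_c :: "'g topgroup \<Rightarrow> 'r topgroup \<Rightarrow> 'a topgroup \<Rightarrow> ('g \<Rightarrow> 'r \<Rightarrow> 'r) \<Rightarrow>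
    ('g \<Rightarrow> 'a \<Rightarrow> 'a) \<Rightarrow> ('a \<Rightarrow> 'r) \<Rightarrow> (('g \<Rightarrow> 'a) \<times> 'r) set" where
  "Der_c G R A actGR actGA \<mu> = {(\<alpha>, r). \<alpha> \<in> crossed_homs G A actGA \<and> r \<in> carrier R \<and>
     (\<forall>g \<in> carrier G. \<mu> (\<alpha> g) = r \<otimes>\<^bsub>R\<^esub> actGR g (inv\<^bsub>R\<^esub> r))}"

definition Der_rel :: "'g topgroup \<Rightarrow> 'r topgroup \<Rightarrow> 'a topgroup \<Rightarrow> ('g \<Rightarrow> 'r \<Rightarrow> 'r) \<Rightarrow>
    ('g \<Rightarrow> 'a \<Rightarrow> 'a) \<Rightarrow> ('a \<Rightarrow> 'r) \<Rightarrow> ((('g \<Rightarrow> 'a) \<times> 'r) \<times> (('g \<Rightarrow> 'a) \<times> 'r)) set" where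
  "Der_rel G R A actGR actGA \<mu> = {((\<alpha>, r), (\<beta>, s)).
     (\<alpha>, r) \<in> Der_c G R A actGR actGA \<mu> \<and> (\<beta>, s) \<in> Der_c G R A actGR actGA \<mu> \<and>
     (\<exists>a \<in> carrier A. (\<forall>g \<in> carrier G. \<beta> g = inv\<^bsub>A\<^esub> a \<otimes>\<^bsub>A\<^esub> \<alpha> g \<otimes>\<^bsub>A\<^esub> actGA g a) \<and>
        s \<in> (inv\<^bsub>R\<^esub> (\<mu> a) \<otimes>\<^bsub>R\<^esub> r) <#\<^bsub>R\<^esub> H0 G R actGR)}"

definition H1_mu :: "'g topgroup \<Rightarrow> 'r topgroup \<Rightarrow> 'a topgroup \<Rightarrow> ('g \<Rightarrow> 'r \<Rightarrow> 'r) \<Rightarrow>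
    ('g \<Rightarrow> 'a \<Rightarrow> 'a) \<Rightarrow> ('a \<Rightarrow> 'r) \<Rightarrow> (('g \<Rightarrow> 'a) \<times> 'r) set set" where
  "H1_mu G R A actGR actGA \<mu> = Der_c G R A actGR actGA \<mu> // Der_rel G R A actGR actGA \<mu>"

definition H1_mu_class :: "'g topgroup \<Rightarrow> 'r topgroup \<Rightarrow> 'a topgroup \<Rightarrow> ('g \<Rightarrow> 'r \<Rightarrow> 'r) \<Rightarrow>
    ('g \<Rightarrow> 'a \<Rightarrow> 'a) \<Rightarrow> ('a \<Rightarrow> 'r) \<Rightarrow> ('g \<Rightarrow> 'a) \<times> 'r \<Rightarrow> (('g \<Rightarrow> 'a) \<times> 'r) set" where
  "H1_mu_class G R A actGR actGA \<mu> d = Der_rel G R A actGR actGA \<mu> `` {d}"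

text \<open>Maps out of a quotient are given by the union of the classes of the images of all
  representatives (cf. \<open>UN_equiv_class\<close>); where the map is well defined these classes all
  coincide.\<close>

definition zeta ::
  "'g topgroup \<Rightarrow> 'a topgroup \<Rightarrow> ('g \<Rightarrow> 'a \<Rightarrow> 'a) \<Rightarrow> (('g \<Rightarrow> 'a) \<times> 'r) set \<Rightarrow> ('g \<Rightarrow> 'a) set" where
  "zeta G A actGA X = (\<Union>(\<alpha>, r) \<in> X. H1_class G A actGA \<alpha>)"

definition mu1 ::
  "'g topgroup \<Rightarrow> 'r topgroup \<Rightarrow> ('g \<Rightarrow> 'r \<Rightarrow> 'r) \<Rightarrow> ('a \<Rightarrow> 'r) \<Rightarrow> ('g \<Rightarrow> 'a) set \<Rightarrow> ('g \<Rightarrow> 'r) set" where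
  "mu1 G R actGR \<mu> X = (\<Union>\<alpha> \<in> X. H1_class G R actGR (compose (carrier G) \<mu> \<alpha>))"

end

theory Submission
  imports Defs
begin

text \<open>If \<open>\<beta> g = a\<inverse> \<alpha>(g) \<^sup>ga\<close> with \<open>\<mu>(\<alpha> g) = r \<^sup>gr\<inverse>\<close> and \<open>\<mu>(\<beta> g) = s \<^sup>gs\<inverse>\<close>, then applying \<open>\<mu>\<close>
  shows that \<open>r\<inverse> \<mu>(a) s\<close> is \<open>G\<close>-invariant, which is the condition on \<open>s\<close> in \<open>\<sim>'\<close>. So \<open>\<sim>'\<close> only
  compares first components, and \<open>\<zeta>\<close> is injective. Moreover \<open>\<mu>(\<alpha> g) = r \<^sup>gr\<inverse>\<close> holds for some
  \<open>r\<close> iff \<open>\<mu> \<circ> \<alpha>\<close> is cohomologous to the trivial crossed homomorphism, so the image of \<open>\<zeta>\<close> is the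
  kernel of \<open>\<mu>\<^sup>1\<close>.\<close>

text \<open>Rewriting with \<open>m_assoc\<close> brackets every product to the right, so an
  adjacent pair of mutually inverse factors shows up with a remaining tail \<open>y\<close>. These
  are the cancellation rules for that normal form.\<close>

lemma (in group) inv_mult_cancel_left:
  "\<lbrakk>x \<in> carrier G; y \<in> carrier G\<rbrakk> \<Longrightarrow> inv x \<otimes> (x \<otimes> y) = y"
  "\<lbrakk>x \<in> carrier G; y \<in> carrier G\<rbrakk> \<Longrightarrow> x \<otimes> (inv x \<otimes> y) = y"
  by (simp_all flip: m_assoc)

text \<open>Meant for \<open>f = fst\<close>, which sends a pair (\<alpha>, r) to \<alpha>: the
  relation \<sim>' will turn out to be the pullback of \<open>cohomologous\<close> along it.\<close>

lemma equiv_pullback: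
  assumes "equiv A r" and "f ` B \<subseteq> A"
  shows "equiv B {(x, y). x \<in> B \<and> y \<in> B \<and> (f x, f y) \<in> r}"
proof (rule equivI)
  have refl: "refl_on A r" and sym: "sym r" and trans: "trans r"
    using assms(1) by (auto elim: equivE)
  show "{(x, y). x \<in> B \<and> y \<in> B \<and> (f x, f y) \<in> r} \<subseteq> B \<times> B"
    by blast
  show "refl_on B {(x, y). x \<in> B \<and> y \<in> B \<and> (f x, f y) \<in> r}"
    using refl assms(2) by (auto simp: refl_on_def)
  show "sym {(x, y). x \<in> B \<and> y \<in> B \<and> (f x, f y) \<in> r}"
    using sym by (auto intro!: symI dest: symD)
  show "trans {(x, y). x \<in> B \<and> y \<in> B \<and> (f x, f y) \<in> r}"
    using trans by (auto intro!: transI dest: transD)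
qed

section \<open>First cohomology of a single topological module\<close>

context topological_module
begin

lemma act_closed [simp]: "\<lbrakk>g \<in> carrier G; m \<in> carrier M\<rbrakk> \<Longrightarrow> act g m \<in> carrier M"
  using act_hom by (blast dest: hom_in_carrier)

lemma act_mult_distrib:
  "\<lbrakk>g \<in> carrier G; m \<in> carrier M; n \<in> carrier M\<rbrakk>
    \<Longrightarrow> act g (m \<otimes>\<^bsub>M\<^esub> n) = act g m \<otimes>\<^bsub>M\<^esub> act g n"
  using act_hom hom_mult by metis

lemma act_group_hom: "g \<in> carrier G \<Longrightarrow> group_hom M M (act g)"
  by (simp add: group_hom_def group_hom_axioms_def act_hom M.group_axioms)

lemma act_unit: "g \<in> carrier G \<Longrightarrow> act g \<one>\<^bsub>M\<^esub> = \<one>\<^bsub>M\<^esub>"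
  by (rule group_hom.hom_one [OF act_group_hom])

lemma act_inv: "\<lbrakk>g \<in> carrier G; m \<in> carrier M\<rbrakk> \<Longrightarrow> act g (inv\<^bsub>M\<^esub> m) = inv\<^bsub>M\<^esub> (act g m)"
  by (rule group_hom.hom_inv [OF act_group_hom])

lemma crossed_homs_closed:
  "\<lbrakk>\<alpha> \<in> crossed_homs G M act; g \<in> carrier G\<rbrakk> \<Longrightarrow> \<alpha> g \<in> carrier M"
  unfolding crossed_homs_def by auto

lemma trivial_crossed_hom: "(\<lambda>g \<in> carrier G. \<one>\<^bsub>M\<^esub>) \<in> crossed_homs G M act"
proof -
  have "continuous_map (topo G) (topo M) (\<lambda>g \<in> carrier G. \<one>\<^bsub>M\<^esub>)"
    by (rule continuous_map_eq [of _ _ "\<lambda>_. \<one>\<^bsub>M\<^esub>"])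
      (simp_all add: G.topspace_topo M.topspace_topo)
  then show ?thesis
    by (auto simp: crossed_homs_def act_unit)
qed

text \<open>Twisting by m behaves like a right action of M: the unit twists trivially, twisting by
  the inverse of m undoes twisting by m, and twisting by m and then by n is twisting by their
  product. These give the three witnesses.\<close>

lemma equiv_cohomologous: "equiv (crossed_homs G M act) (cohomologous G M act)"
proof (rule equivI)
  show "cohomologous G M act \<subseteq> crossed_homs G M act \<times> crossed_homs G M act"
    by (auto simp: cohomologous_def)
  show "refl_on (crossed_homs G M act) (cohomologous G M act)"
    by (auto simp: refl_on_def cohomologous_def act_unit crossed_homs_closed
        intro!: bexI [of _ "\<one>\<^bsub>M\<^esub>"])
  show "sym (cohomologous G M act)"
  proof (rule symI)
    fix \<alpha> \<beta> assume "(\<alpha>, \<beta>) \<in> cohomologous G M act"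
    then obtain m where m: "m \<in> carrier M"
      and hom: "\<alpha> \<in> crossed_homs G M act" "\<beta> \<in> crossed_homs G M act"
      and \<beta>: "\<And>g. g \<in> carrier G \<Longrightarrow> \<beta> g = inv\<^bsub>M\<^esub> m \<otimes>\<^bsub>M\<^esub> \<alpha> g \<otimes>\<^bsub>M\<^esub> act g m"
      by (auto simp: cohomologous_def)
    have "\<alpha> g = inv\<^bsub>M\<^esub> (inv\<^bsub>M\<^esub> m) \<otimes>\<^bsub>M\<^esub> \<beta> g \<otimes>\<^bsub>M\<^esub> act g (inv\<^bsub>M\<^esub> m)" if "g \<in> carrier G" for g
      using that m crossed_homs_closed [OF hom(1) that]
      by (simp add: \<beta> act_inv M.m_assoc M.inv_mult_cancel_left)
    then show "(\<beta>, \<alpha>) \<in> cohomologous G M act"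
      using m hom unfolding cohomologous_def by (blast intro: M.inv_closed)
  qed
  show "trans (cohomologous G M act)"
  proof (rule transI)
    fix \<alpha> \<beta> \<gamma>
    assume "(\<alpha>, \<beta>) \<in> cohomologous G M act" "(\<beta>, \<gamma>) \<in> cohomologous G M act"
    then obtain m n where mn: "m \<in> carrier M" "n \<in> carrier M"
      and hom: "\<alpha> \<in> crossed_homs G M act" "\<gamma> \<in> crossed_homs G M act"
      and \<beta>: "\<And>g. g \<in> carrier G \<Longrightarrow> \<beta> g = inv\<^bsub>M\<^esub> m \<otimes>\<^bsub>M\<^esub> \<alpha> g \<otimes>\<^bsub>M\<^esub> act g m"
      and \<gamma>: "\<And>g. g \<in> carrier G \<Longrightarrow> \<gamma> g = inv\<^bsub>M\<^esub> n \<otimes>\<^bsub>M\<^esub> \<beta> g \<otimes>\<^bsub>M\<^esub> act g n"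
      by (auto simp: cohomologous_def)
    have "\<gamma> g = inv\<^bsub>M\<^esub> (m \<otimes>\<^bsub>M\<^esub> n) \<otimes>\<^bsub>M\<^esub> \<alpha> g \<otimes>\<^bsub>M\<^esub> act g (m \<otimes>\<^bsub>M\<^esub> n)" if "g \<in> carrier G" for g
      using that mn crossed_homs_closed [OF hom(1) that]
      by (simp add: \<beta> \<gamma> act_mult_distrib M.m_assoc M.inv_mult_group)
    then show "(\<alpha>, \<gamma>) \<in> cohomologous G M act"
      using mn hom unfolding cohomologous_def by (blast intro: M.m_closed)
  qed
qed

lemma H1_class_eq_iff:
  "\<lbrakk>\<alpha> \<in> crossed_homs G M act; \<beta> \<in> crossed_homs G M act\<rbrakk>
    \<Longrightarrow> H1_class G M act \<alpha> = H1_class G M act \<beta> \<longleftrightarrow> (\<alpha>, \<beta>) \<in> cohomologous G M act"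
  unfolding H1_class_def by (rule eq_equiv_class_iff [OF equiv_cohomologous])

lemma H1_class_in_H1: "\<alpha> \<in> crossed_homs G M act \<Longrightarrow> H1_class G M act \<alpha> \<in> H1 G M act"
  unfolding H1_class_def H1_def by (rule quotientI)

text \<open>Twisting the trivial crossed homomorphism by the inverse of r gives
  \<open>r \<otimes> act g (inv r)\<close>, which is the shape of the condition in
  \<open>Der_c\<close>.\<close>

lemma H1_class_eq_base_iff:
  assumes \<alpha>: "\<alpha> \<in> crossed_homs G M act"
  shows "H1_class G M act \<alpha> = H1_base G M act \<longleftrightarrow>
    (\<exists>r \<in> carrier M. \<forall>g \<in> carrier G. \<alpha> g = r \<otimes>\<^bsub>M\<^esub> act g (inv\<^bsub>M\<^esub> r))"
    (is "_ \<longleftrightarrow> ?coboundary")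
proof -
  let ?\<epsilon> = "\<lambda>g \<in> carrier G. \<one>\<^bsub>M\<^esub>"
  \<comment> \<open>The equation is turned around so that unfolding \<open>cohomologous\<close>
    exhibits \<alpha> as a twist of the trivial map, not the reverse.\<close>
  have "H1_class G M act \<alpha> = H1_base G M act \<longleftrightarrow> H1_class G M act ?\<epsilon> = H1_class G M act \<alpha>"
    unfolding H1_base_def by auto
  also have "\<dots> \<longleftrightarrow> (?\<epsilon>, \<alpha>) \<in> cohomologous G M act"
    by (rule H1_class_eq_iff [OF trivial_crossed_hom \<alpha>])
  also have "\<dots> \<longleftrightarrow> (\<exists>m \<in> carrier M. \<forall>g \<in> carrier G. \<alpha> g = inv\<^bsub>M\<^esub> m \<otimes>\<^bsub>M\<^esub> act g m)"
    using trivial_crossed_hom \<alpha> by (simp add: cohomologous_def)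
  \<comment> \<open>Substitute r = \<open>inv m\<close>, a bijection of the carrier.\<close>
  also have "\<dots> \<longleftrightarrow> ?coboundary"
    using M.inv_closed M.inv_inv by metis
  finally show ?thesis .
qed

end

section \<open>Pushing crossed homomorphisms forward along \<mu>\<close>

context partially_crossed_topological_bimodule
begin

lemma mu_group_hom: "group_hom A R \<mu>"
  by (simp add: group_hom_def group_hom_axioms_def mu_hom G.group_axioms M.group_axioms)

lemmas mu_closed [simp] = group_hom.hom_closed [OF mu_group_hom]
  and mu_mult = group_hom.hom_mult [OF mu_group_hom]
  and mu_inv = group_hom.hom_inv [OF mu_group_hom]

text \<open>The crossed identity survives because \<mu> is a G-equivariant homomorphism. Using
  \<open>compose\<close> keeps the composite extensional; it agrees with the plain composite on the
  carrier, which is the whole topological space, so continuity carries over.\<close>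

lemma compose_mu_crossed_hom:
  assumes \<alpha>: "\<alpha> \<in> crossed_homs G A actGA"
  shows "compose (carrier G) \<mu> \<alpha> \<in> crossed_homs G R actGR"
proof -
  have "continuous_map (topo G) (topo R) (\<mu> \<circ> \<alpha>)"
    using \<alpha> continuous_mu by (auto simp: crossed_homs_def intro: continuous_map_compose)
  then have "continuous_map (topo G) (topo R) (compose (carrier G) \<mu> \<alpha>)"
    by (rule continuous_map_eq) (simp add: GR.G.topspace_topo compose_def)
  then show ?thesis
    using \<alpha> GA.crossed_homs_closed [OF \<alpha>]
    by (auto simp: crossed_homs_def compose_def mu_mult mu_equivariant)
qed

lemma mu_twist:
  assumes "\<alpha> \<in> crossed_homs G A actGA" "a \<in> carrier A" "g \<in> carrier G"
  shows "\<mu> (inv\<^bsub>A\<^esub> a \<otimes>\<^bsub>A\<^esub> \<alpha> g \<otimes>\<^bsub>A\<^esub> actGA g a)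
    = inv\<^bsub>R\<^esub> (\<mu> a) \<otimes>\<^bsub>R\<^esub> \<mu> (\<alpha> g) \<otimes>\<^bsub>R\<^esub> actGR g (\<mu> a)"
  using assms GA.crossed_homs_closed [OF assms(1,3)]
  by (simp add: mu_mult mu_inv mu_equivariant)

lemma compose_mu_cohomologous:
  assumes "(\<alpha>, \<beta>) \<in> cohomologous G A actGA"
  shows "(compose (carrier G) \<mu> \<alpha>, compose (carrier G) \<mu> \<beta>) \<in> cohomologous G R actGR"
proof -
  obtain a where a: "a \<in> carrier A"
    and hom: "\<alpha> \<in> crossed_homs G A actGA" "\<beta> \<in> crossed_homs G A actGA"
    and \<beta>: "\<And>g. g \<in> carrier G \<Longrightarrow> \<beta> g = inv\<^bsub>A\<^esub> a \<otimes>\<^bsub>A\<^esub> \<alpha> g \<otimes>\<^bsub>A\<^esub> actGA g a"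
    using assms by (auto simp: cohomologous_def)
  have "compose (carrier G) \<mu> \<beta> g
      = inv\<^bsub>R\<^esub> (\<mu> a) \<otimes>\<^bsub>R\<^esub> compose (carrier G) \<mu> \<alpha> g \<otimes>\<^bsub>R\<^esub> actGR g (\<mu> a)"
    if "g \<in> carrier G" for g
    using that mu_twist [OF hom(1) a that] by (simp add: compose_def \<beta>)
  then show ?thesis
    using a hom compose_mu_crossed_hom mu_closed unfolding cohomologous_def by blast
qed

section \<open>The relation \<sim>' on \<open>Der_c\<close>\<close>

lemma Der_c_crossed_hom: "(\<alpha>, r) \<in> Der_c G R A actGR actGA \<mu> \<Longrightarrow> \<alpha> \<in> crossed_homs G A actGA"
  by (simp add: Der_c_def)

lemma Der_rel_iff_cohomologous:
  assumes \<alpha>r: "(\<alpha>, r) \<in> Der_c G R A actGR actGA \<mu>" and \<beta>s: "(\<beta>, s) \<in> Der_c G R A actGR actGA \<mu>"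
  shows "((\<alpha>, r), (\<beta>, s)) \<in> Der_rel G R A actGR actGA \<mu> \<longleftrightarrow> (\<alpha>, \<beta>) \<in> cohomologous G A actGA"
proof
  show "(\<alpha>, \<beta>) \<in> cohomologous G A actGA" if "((\<alpha>, r), (\<beta>, s)) \<in> Der_rel G R A actGR actGA \<mu>"
    using that by (auto simp: Der_rel_def Der_c_def cohomologous_def)
next
  assume "(\<alpha>, \<beta>) \<in> cohomologous G A actGA"
  then obtain a where a: "a \<in> carrier A"
    and \<beta>: "\<forall>g \<in> carrier G. \<beta> g = inv\<^bsub>A\<^esub> a \<otimes>\<^bsub>A\<^esub> \<alpha> g \<otimes>\<^bsub>A\<^esub> actGA g a"
    by (auto simp: cohomologous_def)
  have rs: "r \<in> carrier R" "s \<in> carrier R"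
    using \<alpha>r \<beta>s by (auto simp: Der_c_def)
  \<comment> \<open>This is the solution of s = \<mu>(a)^{-1} r h, so the coset condition on s
    follows once h is G-invariant.\<close>
  define h where "h = inv\<^bsub>R\<^esub> r \<otimes>\<^bsub>R\<^esub> \<mu> a \<otimes>\<^bsub>R\<^esub> s"
  have h: "h \<in> carrier R"
    using a rs by (simp add: h_def)
  have "actGR g h = h" if g: "g \<in> carrier G" for g
  proof -
    \<comment> \<open>Compute \<mu>(\<beta> g) in two ways: from (\<beta>, s) lying in
      \<open>Der_c\<close>, and from \<beta> being the twist of \<alpha> by a.\<close>
    have "s \<otimes>\<^bsub>R\<^esub> actGR g (inv\<^bsub>R\<^esub> s) = \<mu> (\<beta> g)"
      using \<beta>s g by (simp add: Der_c_def)
    also have "\<dots> = inv\<^bsub>R\<^esub> (\<mu> a) \<otimes>\<^bsub>R\<^esub> (r \<otimes>\<^bsub>R\<^esub> actGR g (inv\<^bsub>R\<^esub> r)) \<otimes>\<^bsub>R\<^esub> actGR g (\<mu> a)"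
      using \<alpha>r g mu_twist [OF Der_c_crossed_hom [OF \<alpha>r] a g] \<beta> by (simp add: Der_c_def)
    finally have eq: "s \<otimes>\<^bsub>R\<^esub> actGR g (inv\<^bsub>R\<^esub> s)
      = inv\<^bsub>R\<^esub> (\<mu> a) \<otimes>\<^bsub>R\<^esub> (r \<otimes>\<^bsub>R\<^esub> actGR g (inv\<^bsub>R\<^esub> r)) \<otimes>\<^bsub>R\<^esub> actGR g (\<mu> a)" .
    \<comment> \<open>The last factor s of h is expanded so that the left side of \<open>eq\<close>
      appears. After substitution r and \<mu>(a) cancel against their inverses, and only the images
      under g of the three factors of h remain.\<close>
    have "h = inv\<^bsub>R\<^esub> r \<otimes>\<^bsub>R\<^esub> \<mu> a \<otimes>\<^bsub>R\<^esub> (s \<otimes>\<^bsub>R\<^esub> actGR g (inv\<^bsub>R\<^esub> s)) \<otimes>\<^bsub>R\<^esub> actGR g s"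
      using a g rs by (simp add: h_def GR.act_inv G.m_assoc)
    also have "\<dots> = actGR g h"
      unfolding eq using a g rs
      by (simp add: h_def GR.act_inv GR.act_mult_distrib G.m_assoc G.inv_mult_cancel_left)
    finally show ?thesis ..
  qed
  then have "h \<in> H0 G R actGR"
    using h by (simp add: H0_def)
  moreover have "s = (inv\<^bsub>R\<^esub> (\<mu> a) \<otimes>\<^bsub>R\<^esub> r) \<otimes>\<^bsub>R\<^esub> h"
    using a rs by (simp add: h_def G.m_assoc G.inv_mult_cancel_left)
  ultimately have "s \<in> (inv\<^bsub>R\<^esub> (\<mu> a) \<otimes>\<^bsub>R\<^esub> r) <#\<^bsub>R\<^esub> H0 G R actGR"
    unfolding l_coset_def by blast
  then show "((\<alpha>, r), (\<beta>, s)) \<in> Der_rel G R A actGR actGA \<mu>"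
    using \<alpha>r \<beta>s a \<beta> unfolding Der_rel_def by blast
qed

text \<open>Since \<sim>' is determined by first components within \<open>Der_c\<close>, it inherits
  the equivalence laws from \<open>cohomologous\<close>, with no separate computation for the cosets
  of \<open>H0\<close>.\<close>

lemma equiv_Der_rel: "equiv (Der_c G R A actGR actGA \<mu>) (Der_rel G R A actGR actGA \<mu>)"
proof -
  let ?D = "Der_c G R A actGR actGA \<mu>"
  have "((d, e) \<in> Der_rel G R A actGR actGA \<mu>) =
      (d \<in> ?D \<and> e \<in> ?D \<and> (fst d, fst e) \<in> cohomologous G A actGA)" for d e
  proof (cases "d \<in> ?D \<and> e \<in> ?D")
    case True
    then show ?thesis
      using Der_rel_iff_cohomologous [of "fst d" "snd d" "fst e" "snd e"] by simp
  next
    case False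
    then show ?thesis
      by (auto simp: Der_rel_def)
  qed
  then have Der_rel_eq: "Der_rel G R A actGR actGA \<mu> =
      {(d, e). d \<in> ?D \<and> e \<in> ?D \<and> (fst d, fst e) \<in> cohomologous G A actGA}"
    by auto
  have "fst ` ?D \<subseteq> crossed_homs G A actGA"
    by (auto dest: Der_c_crossed_hom)
  then show ?thesis
    unfolding Der_rel_eq by (rule equiv_pullback [OF GA.equiv_cohomologous])
qed

section \<open>The map \<zeta> and its injectivity\<close>

lemma H1_class_respects_Der_rel:
  "(\<lambda>(\<alpha>, r). H1_class G A actGA \<alpha>) respects Der_rel G R A actGR actGA \<mu>"
proof (rule congruentI, clarify)
  fix \<alpha> r \<beta> s assume rel: "((\<alpha>, r), (\<beta>, s)) \<in> Der_rel G R A actGR actGA \<mu>"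
  then have "(\<alpha>, r) \<in> Der_c G R A actGR actGA \<mu>" "(\<beta>, s) \<in> Der_c G R A actGR actGA \<mu>"
    by (auto simp: Der_rel_def)
  with rel show "H1_class G A actGA \<alpha> = H1_class G A actGA \<beta>"
    by (metis Der_rel_iff_cohomologous GA.H1_class_eq_iff Der_c_crossed_hom)
qed

text \<open>The union defining \<open>zeta\<close> runs over equal sets, because equivalent pairs
  have cohomologous first components.\<close>

lemma zeta_class:
  assumes "(\<alpha>, r) \<in> Der_c G R A actGR actGA \<mu>"
  shows "zeta G A actGA (H1_mu_class G R A actGR actGA \<mu> (\<alpha>, r)) = H1_class G A actGA \<alpha>"
  using UN_equiv_class [OF equiv_Der_rel H1_class_respects_Der_rel assms]
  by (simp add: zeta_def H1_mu_class_def)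

lemma H1_mu_cases:
  assumes "X \<in> H1_mu G R A actGR actGA \<mu>"
  obtains \<alpha> r where "(\<alpha>, r) \<in> Der_c G R A actGR actGA \<mu>"
    and "X = H1_mu_class G R A actGR actGA \<mu> (\<alpha>, r)"
  using assms unfolding H1_mu_def H1_mu_class_def by (auto elim!: quotientE)

lemma zeta_in_H1: "zeta G A actGA \<in> H1_mu G R A actGR actGA \<mu> \<rightarrow> H1 G A actGA"
  using zeta_class Der_c_crossed_hom GA.H1_class_in_H1 by (auto elim!: H1_mu_cases)

lemma inj_on_zeta: "inj_on (zeta G A actGA) (H1_mu G R A actGR actGA \<mu>)"
proof (rule inj_onI)
  fix X Y assume X: "X \<in> H1_mu G R A actGR actGA \<mu>" and Y: "Y \<in> H1_mu G R A actGR actGA \<mu>"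
    and eq: "zeta G A actGA X = zeta G A actGA Y"
  obtain \<alpha> r where \<alpha>: "(\<alpha>, r) \<in> Der_c G R A actGR actGA \<mu>"
      "X = H1_mu_class G R A actGR actGA \<mu> (\<alpha>, r)"
    using X by (rule H1_mu_cases)
  obtain \<beta> s where \<beta>: "(\<beta>, s) \<in> Der_c G R A actGR actGA \<mu>"
      "Y = H1_mu_class G R A actGR actGA \<mu> (\<beta>, s)"
    using Y by (rule H1_mu_cases)
  have "(\<alpha>, \<beta>) \<in> cohomologous G A actGA"
    using eq \<alpha> \<beta> by (simp add: zeta_class GA.H1_class_eq_iff Der_c_crossed_hom)
  then have "((\<alpha>, r), (\<beta>, s)) \<in> Der_rel G R A actGR actGA \<mu>"
    using Der_rel_iff_cohomologous \<alpha>(1) \<beta>(1) by blast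
  then show "X = Y"
    unfolding \<alpha>(2) \<beta>(2) H1_mu_class_def by (rule equiv_class_eq [OF equiv_Der_rel])
qed

section \<open>The induced map on cohomology and its kernel\<close>

lemma mu1_class:
  assumes "\<alpha> \<in> crossed_homs G A actGA"
  shows "mu1 G R actGR \<mu> (H1_class G A actGA \<alpha>) = H1_class G R actGR (compose (carrier G) \<mu> \<alpha>)"
proof -
  \<comment> \<open>If \<beta> is the twist of \<alpha> by a, then its image under \<mu> is the
    twist by \<mu>(a), so the classes agree.\<close>
  have "(\<lambda>\<alpha>. H1_class G R actGR (compose (carrier G) \<mu> \<alpha>)) respects cohomologous G A actGA"
    unfolding H1_class_def
    by (rule congruentI) (rule equiv_class_eq [OF GR.equiv_cohomologous compose_mu_cohomologous])
  then show ?thesis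
    using UN_equiv_class [OF GA.equiv_cohomologous _ assms]
    unfolding mu1_def H1_class_def [of G A] by blast
qed

lemma H1_A_cases:
  assumes "x \<in> H1 G A actGA"
  obtains \<alpha> where "\<alpha> \<in> crossed_homs G A actGA" and "x = H1_class G A actGA \<alpha>"
  using assms unfolding H1_def H1_class_def by (auto elim!: quotientE)

lemma mu1_in_H1: "mu1 G R actGR \<mu> \<in> H1 G A actGA \<rightarrow> H1 G R actGR"
  using mu1_class compose_mu_crossed_hom GR.H1_class_in_H1 by (auto elim!: H1_A_cases)

text \<open>An element r trivializing the composite of \<mu> and \<alpha> is exactly a second
  component completing \<alpha> to a pair in \<open>Der_c\<close>.\<close>

lemma mu1_class_eq_base_iff:
  assumes "\<alpha> \<in> crossed_homs G A actGA"
  shows "mu1 G R actGR \<mu> (H1_class G A actGA \<alpha>) = H1_base G R actGR \<longleftrightarrow>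
    (\<exists>r. (\<alpha>, r) \<in> Der_c G R A actGR actGA \<mu>)"
proof -
  have "mu1 G R actGR \<mu> (H1_class G A actGA \<alpha>) = H1_base G R actGR \<longleftrightarrow>
    (\<exists>r \<in> carrier R. \<forall>g \<in> carrier G.
      compose (carrier G) \<mu> \<alpha> g = r \<otimes>\<^bsub>R\<^esub> actGR g (inv\<^bsub>R\<^esub> r))"
    unfolding mu1_class [OF assms]
    by (rule GR.H1_class_eq_base_iff [OF compose_mu_crossed_hom [OF assms]])
  then show ?thesis
    using assms by (auto simp: Der_c_def compose_def)
qed

lemma zeta_image:
  "zeta G A actGA ` H1_mu G R A actGR actGA \<mu>
    = {x \<in> H1 G A actGA. mu1 G R actGR \<mu> x = H1_base G R actGR}"
proof (intro equalityI subsetI)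
  fix x assume "x \<in> zeta G A actGA ` H1_mu G R A actGR actGA \<mu>"
  then obtain \<alpha> r where "(\<alpha>, r) \<in> Der_c G R A actGR actGA \<mu>" "x = H1_class G A actGA \<alpha>"
    using zeta_class by (auto elim!: H1_mu_cases)
  then show "x \<in> {x \<in> H1 G A actGA. mu1 G R actGR \<mu> x = H1_base G R actGR}"
    using mu1_class_eq_base_iff Der_c_crossed_hom GA.H1_class_in_H1 by blast
next
  fix x assume "x \<in> {x \<in> H1 G A actGA. mu1 G R actGR \<mu> x = H1_base G R actGR}"
  then obtain \<alpha> r where "(\<alpha>, r) \<in> Der_c G R A actGR actGA \<mu>" "x = H1_class G A actGA \<alpha>"
    using mu1_class_eq_base_iff by (auto elim!: H1_A_cases)
  \<comment> \<open>The class of the pair (\<alpha>, r) just obtained is the preimage.\<close>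
  then show "x \<in> zeta G A actGA ` H1_mu G R A actGR actGA \<mu>"
    using zeta_class unfolding H1_mu_def H1_mu_class_def by (metis image_eqI quotientI)
qed

text \<open>As \<zeta> is injective, bijectivity means that its image, the kernel of the induced
  map, is all of \<open>H1 G A actGA\<close>.\<close>

lemma bij_betw_zeta_iff:
  "bij_betw (zeta G A actGA) (H1_mu G R A actGR actGA \<mu>) (H1 G A actGA) \<longleftrightarrow>
    (\<forall>x \<in> H1 G A actGA. mu1 G R actGR \<mu> x = H1_base G R actGR)"
  unfolding bij_betw_def zeta_image using inj_on_zeta by blast

end

theorem theorem2p12:
  fixes G :: "'g topgroup" and R :: "'r topgroup" and A :: "'a topgroup"
    and actGR :: "'g \<Rightarrow> 'r \<Rightarrow> 'r" and actGA :: "'g \<Rightarrow> 'a \<Rightarrow> 'a"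
    and actRA :: "'r \<Rightarrow> 'a \<Rightarrow> 'a" and \<mu> :: "'a \<Rightarrow> 'r"
  assumes "partially_crossed_topological_bimodule G R A actGR actGA actRA \<mu>"
  shows "((\<forall>(\<alpha>, r) \<in> Der_c G R A actGR actGA \<mu>.
            zeta G A actGA (H1_mu_class G R A actGR actGA \<mu> (\<alpha>, r)) = H1_class G A actGA \<alpha>) \<and>
          zeta G A actGA \<in> H1_mu G R A actGR actGA \<mu> \<rightarrow> H1 G A actGA \<and>
          inj_on (zeta G A actGA) (H1_mu G R A actGR actGA \<mu>)) \<and>
         ((\<forall>\<alpha> \<in> crossed_homs G A actGA.
            mu1 G R actGR \<mu> (H1_class G A actGA \<alpha>)
              = H1_class G R actGR (compose (carrier G) \<mu> \<alpha>)) \<and>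
          mu1 G R actGR \<mu> \<in> H1 G A actGA \<rightarrow> H1 G R actGR \<and>
          (bij_betw (zeta G A actGA) (H1_mu G R A actGR actGA \<mu>) (H1 G A actGA) \<longleftrightarrow>
           (\<forall>x \<in> H1 G A actGA. mu1 G R actGR \<mu> x = H1_base G R actGR)))"
proof -
  interpret partially_crossed_topological_bimodule G R A actGR actGA actRA \<mu>
    by (fact assms)
  show ?thesis
    using zeta_class zeta_in_H1 inj_on_zeta mu1_class mu1_in_H1 bij_betw_zeta_iff by auto
qed

end
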